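(* Let $h(f)=f\log f-f$. The relaxation step $(f_1^\ell,f_2^\ell)\mapsto(f_1^{\ell'},f_2^{\ell'})$ of the first-order splitting scheme, defined in the context, satisfies the discrete entropy inequality $$\int\big[h(f_1^{\ell'})+h(f_2^{\ell'})\big]d\mathbf v\le\int\big[h(f_1^\ell)+h(f_2^\ell)\big]d\mathbf v.$$
   Context: Species $i\in\{1,2\}$, with $j$ the other index; masses $m_i>0$; $\mathbf v\in\mathbb R^3$; integrals over $\mathbb R^3$; $\Delta t>0$; $h(0)=0$. The collision frequencies $\nu_{ij}=\nu_{ij}^\ell(\mathbf v)\ge0$ are given functions of $\mathbf v$. The distribution functions $f_i^\ell\ge0$ have finite moments up to order two and $h(f_i^\ell)$ is integrable. Let $\mathbf a_i(\mathbf v)=m_i(1,\mathbf v,|\mathbf v|^2)^\top$, $\mathbf a_{12}=m_1(1,0,\mathbf v,|\mathbf v|^2)^\top$, $\mathbf a_{21}=m_2(0,1,\mathbf v,|\mathbf v|^2)^\top$, $\Lambda=\mathbb R\times\mathbb R^3\times(-\infty,0)$, $\Lambda_{12}=\mathbb R\times\mathbb R\times\mathbb R^3\times(-\infty,0)$ and $c_i=\frac1{1+\Delta t(\nu_{ii}+\nu_{ij})}$. Relaxation step: $$f_i^{\ell'}=c_if_i^\ell+c_i\Delta t(\nu_{ii}A_{ii}+\nu_{ij}A_{ij})$$ (equivalently $f_i^{\ell'}=f_i^\ell+\Delta t[\nu_{ii}(A_{ii}-f_i^{\ell'})+\nu_{ij}(A_{ij}-f_i^{\ell'})]$), where $A_{ii}=e^{\boldsymbol\lambda_i\cdot\mathbf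 a_i}$, $A_{12}=e^{\boldsymbol\lambda\cdot\mathbf a_{12}}$, $A_{21}=e^{\boldsymbol\lambda\cdot\mathbf a_{21}}$; $\boldsymbol\lambda_i$ is the minimizer over $\boldsymbol\alpha\in\Lambda$ of $$\int c_i\nu_{ii}e^{\boldsymbol\alpha\cdot\mathbf a_i}d\mathbf v-\boldsymbol\alpha\cdot\int c_i\nu_{ii}f_i^\ell\mathbf a_i\,d\mathbf v,$$ and $\boldsymbol\lambda$ is the minimizer over $\boldsymbol\alpha\in\Lambda_{12}$ of $$\int\big[c_1\nu_{12}e^{\boldsymbol\alpha\cdot\mathbf a_{12}}+c_2\nu_{21}e^{\boldsymbol\alpha\cdot\mathbf a_{21}}\big]d\mathbf v-\boldsymbol\alpha\cdot\int\big[c_1\nu_{12}f_1^\ell\mathbf a_{12}+c_2\nu_{21}f_2^\ell\mathbf a_{21}\big]d\mathbf v.$$ Standing assumption: these integrals are finite for all $\boldsymbol\alpha$ in $\Lambda$, respectively $\Lambda_{12}$, and the minimizers exist and are unique. *)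

theory Defs
  imports "HOL-Analysis.Analysis"
begin

type_synonym velocity = "real ^ 3"

definition h_entropy :: "real \<Rightarrow> real" where
  "h_entropy x = x * ln x - x"

lemma h_entropy_0: "h_entropy 0 = 0"
  by (simp add: h_entropy_def)

definition avec :: "real \<Rightarrow> velocity \<Rightarrow> real \<times> velocity \<times> real" where
  "avec m v = m *\<^sub>R (1, v, (norm v)\<^sup>2)"

definition avec12 :: "real \<Rightarrow> velocity \<Rightarrow> real \<times> real \<times> velocity \<times> real" where
  "avec12 m1 v = m1 *\<^sub>R (1, 0, v, (norm v)\<^sup>2)"

definition avec21 :: "real \<Rightarrow> velocity \<Rightarrow> real \<times> real \<times> velocity \<times> real" where
  "avec21 m2 v = m2 *\<^sub>R (0, 1, v, (norm v)\<^sup>2)"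

definition Lam :: "(real \<times> velocity \<times> real) set" where
  "Lam = UNIV \<times> UNIV \<times> {..<0}"

definition Lam12 :: "(real \<times> real \<times> velocity \<times> real) set" where
  "Lam12 = UNIV \<times> UNIV \<times> UNIV \<times> {..<0}"

text \<open>Below, \<open>\<nu>s\<close> is the collision frequency of a species with itself and \<open>\<nu>x\<close> the one
  with the other species.\<close>

definition relax_coeff :: "real \<Rightarrow> (velocity \<Rightarrow> real) \<Rightarrow> (velocity \<Rightarrow> real) \<Rightarrow> velocity \<Rightarrow> real" where
  "relax_coeff dt \<nu>s \<nu>x v = 1 / (1 + dt * (\<nu>s v + \<nu>x v))"

definition potential ::
  "real \<Rightarrow> real \<Rightarrow> (velocity \<Rightarrow> real) \<Rightarrow> (velocity \<Rightarrow> real) \<Rightarrow> (velocity \<Rightarrow> real)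
    \<Rightarrow> real \<times> velocity \<times> real \<Rightarrow> real" where
  "potential m dt \<nu>s \<nu>x f \<alpha> =
    (\<integral>v. relax_coeff dt \<nu>s \<nu>x v * \<nu>s v * exp (\<alpha> \<bullet> avec m v) \<partial>lebesgue)
    - \<alpha> \<bullet> (\<integral>v. (relax_coeff dt \<nu>s \<nu>x v * \<nu>s v * f v) *\<^sub>R avec m v \<partial>lebesgue)"

definition potential12 ::
  "real \<Rightarrow> real \<Rightarrow> real \<Rightarrow> (velocity \<Rightarrow> real) \<Rightarrow> (velocity \<Rightarrow> real) \<Rightarrow> (velocity \<Rightarrow> real)
    \<Rightarrow> (velocity \<Rightarrow> real) \<Rightarrow> (velocity \<Rightarrow> real) \<Rightarrow> (velocity \<Rightarrow> real)
    \<Rightarrow> real \<times> real \<times> velocity \<times> real \<Rightarrow> real" where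
  "potential12 m1 m2 dt \<nu>11 \<nu>12 \<nu>21 \<nu>22 f1 f2 \<alpha> =
    (\<integral>v. relax_coeff dt \<nu>11 \<nu>12 v * \<nu>12 v * exp (\<alpha> \<bullet> avec12 m1 v)
        + relax_coeff dt \<nu>22 \<nu>21 v * \<nu>21 v * exp (\<alpha> \<bullet> avec21 m2 v) \<partial>lebesgue)
    - \<alpha> \<bullet> (\<integral>v. (relax_coeff dt \<nu>11 \<nu>12 v * \<nu>12 v * f1 v) *\<^sub>R avec12 m1 v
           + (relax_coeff dt \<nu>22 \<nu>21 v * \<nu>21 v * f2 v) *\<^sub>R avec21 m2 v \<partial>lebesgue)"

definition relax ::
  "real \<Rightarrow> (velocity \<Rightarrow> real) \<Rightarrow> (velocity \<Rightarrow> real) \<Rightarrow> (velocity \<Rightarrow> real) \<Rightarrow> (velocity \<Rightarrow> real)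
    \<Rightarrow> (velocity \<Rightarrow> real) \<Rightarrow> velocity \<Rightarrow> real" where
  "relax dt \<nu>s \<nu>x As Ax f v =
    relax_coeff dt \<nu>s \<nu>x v * f v
    + relax_coeff dt \<nu>s \<nu>x v * dt * (\<nu>s v * As v + \<nu>x v * Ax v)"

text \<open>\<^const>\<open>arg_min_on\<close> is the minimizer only when one exists, and it is a choice among
  minimizers unless it is unique; both are to be assumed whenever this is used.\<close>

definition relaxation_step ::
  "real \<Rightarrow> real \<Rightarrow> real \<Rightarrow> (velocity \<Rightarrow> real) \<Rightarrow> (velocity \<Rightarrow> real) \<Rightarrow> (velocity \<Rightarrow> real)
    \<Rightarrow> (velocity \<Rightarrow> real) \<Rightarrow> (velocity \<Rightarrow> real) \<times> (velocity \<Rightarrow> real)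
    \<Rightarrow> (velocity \<Rightarrow> real) \<times> (velocity \<Rightarrow> real)" where
  "relaxation_step m1 m2 dt \<nu>11 \<nu>12 \<nu>21 \<nu>22 = (\<lambda>(f1, f2).
    let l1 = arg_min_on (potential m1 dt \<nu>11 \<nu>12 f1) Lam;
        l2 = arg_min_on (potential m2 dt \<nu>22 \<nu>21 f2) Lam;
        l12 = arg_min_on (potential12 m1 m2 dt \<nu>11 \<nu>12 \<nu>21 \<nu>22 f1 f2) Lam12
    in (relax dt \<nu>11 \<nu>12 (\<lambda>v. exp (l1 \<bullet> avec m1 v)) (\<lambda>v. exp (l12 \<bullet> avec12 m1 v)) f1,
        relax dt \<nu>22 \<nu>21 (\<lambda>v. exp (l2 \<bullet> avec m2 v)) (\<lambda>v. exp (l12 \<bullet> avec21 m2 v)) f2))"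

end

theory Submission
  imports Defs "HOL-Probability.Distributions"
begin

text \<open>
  Since \<open>c\<^sub>i (1 + \<Delta>t (\<nu>\<^sub>i\<^sub>i + \<nu>\<^sub>i\<^sub>j)) = 1\<close>, the relaxed distribution is at each velocity a convex
  combination of \<open>f\<^sub>i\<close>, \<open>A\<^sub>i\<^sub>i\<close> and \<open>A\<^sub>i\<^sub>j\<close>, so by convexity of \<open>h\<close> it suffices that the targets do not have
  more weighted entropy than the data. Young's inequality \<open>s x - e\<^sup>s \<le> h x\<close> with \<open>s = log A\<close> bounds the
  increase of the weighted entropy by \<open>\<integral> w (A - f) log A\<close>. As \<open>log A = \<lambda> \<bullet> a\<close>, this is the derivative at
  \<open>t = 1\<close> of the potential along the ray \<open>t \<lambda>\<close>. The domains are cones, so the ray stays inside them and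
  the derivative vanishes at the minimizer; in the cross-species case only the sum of the two
  derivatives does.
\<close>

section \<open>Integrability of product-valued functions and of the Gaussian\<close>

lemma integrable_Pair:
  fixes f :: "'a \<Rightarrow> 'b::euclidean_space" and g :: "'a \<Rightarrow> 'c::euclidean_space"
  assumes "integrable M f" "integrable M g"
  shows "integrable M (\<lambda>x. (f x, g x))"
proof -
  have "bounded_linear (\<lambda>x::'b. (x, 0::'c))" "bounded_linear (\<lambda>y::'c. (0::'b, y))"
    by (intro bounded_linear_Pair bounded_linear_ident bounded_linear_zero)+
  note this[THEN integrable_bounded_linear]
  from Bochner_Integration.integrable_add[OF this(1)[OF assms(1)] this(2)[OF assms(2)]]
  have "integrable M (\<lambda>x. (f x, 0::'c) + (0, g x))" .
  then show ?thesis by simp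
qed

text \<open>The exponential of the squared norm factors over the coordinates, each factor being a
  multiple of the standard normal density; \<open>lborel_eq\<close> carries the product integral
  over to the space. The Gaussian is the exponential term that Young's inequality leaves in the
  lower entropy bound of \<open>relax_entropy\<close>.\<close>

lemma integrable_gaussian:
  "integrable lborel (\<lambda>v::'a::euclidean_space. exp (- (norm v)\<^sup>2 / 2))"
proof -
  have 1: "integrable lborel (\<lambda>x::real. exp (- x\<^sup>2 / 2))"
  proof -
    have "integrable lborel (\<lambda>x. sqrt (2 * pi) * normal_density 0 1 x)"
      by (intro integrable_mult_right integrable_normal_density) auto
    then show ?thesis
      by (simp add: normal_density_def)
  qed
  have "integrable (\<Pi>\<^sub>M b\<in>(Basis::'a set). lborel) (\<lambda>x. \<Prod>b\<in>Basis. exp (- (x b)\<^sup>2 / 2 :: real))"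
    by (rule product_sigma_finite.product_integrable_prod)
       (use 1 in \<open>auto simp: product_sigma_finite_def intro: sigma_finite_lborel\<close>)
  also have "(\<lambda>x. \<Prod>b\<in>(Basis::'a set). exp (- (x b)\<^sup>2 / 2)) =
    (\<lambda>x. exp (- (norm (\<Sum>b\<in>(Basis::'a set). x b *\<^sub>R b))\<^sup>2 / 2))"
  proof
    fix x :: "'a \<Rightarrow> real"
    let ?v = "\<Sum>b\<in>Basis. x b *\<^sub>R b"
    have "(norm ?v)\<^sup>2 = (\<Sum>b\<in>Basis. (x b)\<^sup>2)"
      unfolding power2_norm_eq_inner
      by (subst euclidean_inner) (simp add: power2_eq_square inner_sum_left_Basis)
    then show "(\<Prod>b\<in>Basis. exp (- (x b)\<^sup>2 / 2)) = exp (- (norm ?v)\<^sup>2 / 2)"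
      by (simp add: exp_sum[symmetric] sum_negf sum_divide_distrib)
  qed
  finally show ?thesis
    unfolding lborel_eq[where 'a='a] by (subst integrable_distr_eq) auto
qed

section \<open>Differentiating exponential integrals along a ray\<close>

lemma abs_expm1_le: "\<bar>exp x - 1\<bar> \<le> \<bar>x\<bar> * exp \<bar>x\<bar>" for x :: real
proof (cases "x \<ge> 0")
  case True
  have "(1 - x) * exp x \<le> exp (- x) * exp x"
    using exp_ge_add_one_self[of "-x"] by (intro mult_right_mono) auto
  then show ?thesis using True by (simp add: exp_minus algebra_simps)
next
  case False
  have "1 - exp x \<le> - x" using exp_ge_add_one_self[of x] by linarith
  also have "\<dots> * 1 \<le> - x * exp (- x)" using False by (intro mult_left_mono) auto
  finally show ?thesis using False by simp
qed

text \<open>This is the domination, uniform in \<open>s\<close>, for the derivative at parameter 1.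
  The linear factor is absorbed by |g| \<le> 4 exp(|g|/4), and |s| \<le> 1/4 costs another
  exp(|g|/4). The total exponent g + |g|/2 is 3g/2 or g/2 according to the sign of g, so the bound
  uses only exponentials at the positive parameters 3/2 and 1/2.\<close>

lemma exp_difference_quotient_bound:
  fixes g s :: real
  assumes "s \<noteq> 0" "\<bar>s\<bar> \<le> 1/4"
  shows "\<bar>(exp ((1 + s) * g) - exp g) / s\<bar> \<le> 4 * (exp (3/2 * g) + exp (1/2 * g))"
proof -
  have "\<bar>(exp ((1 + s) * g) - exp g) / s\<bar> = exp g * (\<bar>exp (s * g) - 1\<bar> / \<bar>s\<bar>)"
  proof -
    have "exp ((1 + s) * g) - exp g = exp g * (exp (s * g) - 1)"
      by (simp add: algebra_simps exp_add)
    then show ?thesis by (simp add: abs_mult)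
  qed
  also have "\<dots> \<le> exp g * (\<bar>g\<bar> * exp (\<bar>s\<bar> * \<bar>g\<bar>))"
    using abs_expm1_le[of "s * g"] assms
    by (intro mult_left_mono) (auto simp: abs_mult pos_divide_le_eq mult_ac)
  also have "\<dots> \<le> exp g * ((4 * exp (\<bar>g\<bar> / 4)) * exp (\<bar>g\<bar> / 4))"
  proof (intro mult_left_mono mult_mono)
    show "\<bar>g\<bar> \<le> 4 * exp (\<bar>g\<bar> / 4)" using exp_ge_add_one_self[of "\<bar>g\<bar>/4"] by linarith
    show "exp (\<bar>s\<bar> * \<bar>g\<bar>) \<le> exp (\<bar>g\<bar> / 4)"
      using mult_right_mono[OF assms(2), of "\<bar>g\<bar>"] by simp
  qed auto
  also have "\<dots> = 4 * exp (g + \<bar>g\<bar> / 2)"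
    by (simp add: mult_exp_exp)
  also have "\<dots> \<le> 4 * (exp (3/2 * g) + exp (1/2 * g))"
    by (cases "g \<ge> 0") (auto simp: field_simps)
  finally show ?thesis .
qed

text \<open>Dominated convergence is applied to the difference quotients along sequences. It yields
  the integrability of the derivative integrand as well, so no moment of \<open>g\<close> has to be
  assumed.\<close>

lemma exp_integral_DERIV:
  fixes w g :: "'a \<Rightarrow> real"
  assumes [measurable]: "w \<in> borel_measurable M" "g \<in> borel_measurable M"
    and w: "\<And>x. w x \<ge> 0"
    and int: "\<And>t. 0 < t \<Longrightarrow> integrable M (\<lambda>x. w x * exp (t * g x))"
  shows "integrable M (\<lambda>x. w x * (g x * exp (g x)))"
    and "((\<lambda>t. \<integral>x. w x * exp (t * g x) \<partial>M) has_real_derivative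
           (\<integral>x. w x * (g x * exp (g x)) \<partial>M)) (at 1)"
proof -
  let ?q = "\<lambda>s x. w x * ((exp ((1 + s) * g x) - exp (g x)) / s)"
  let ?L = "\<lambda>x. w x * (g x * exp (g x))"
  let ?B = "\<lambda>x. 4 * (w x * exp (3/2 * g x) + w x * exp (1/2 * g x))"
  have B: "integrable M ?B"
    using int[of "3/2"] int[of "1/2"] by (intro integrable_mult_right Bochner_Integration.integrable_add) auto
  have lim: "(\<lambda>n. ?q (S n) x) \<longlonglongrightarrow> ?L x"
    if S: "\<And>n. S n \<noteq> 0" "S \<longlonglongrightarrow> 0" for S x
  proof -
    have "((\<lambda>t. exp (t * g x)) has_real_derivative g x * exp (g x)) (at 1)"
      by (auto intro!: derivative_eq_intros)
    then have "((\<lambda>s. (exp ((1 + s) * g x) - exp (g x)) / s) \<longlongrightarrow> g x * exp (g x)) (at 0)"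
      by (simp add: DERIV_def)
    moreover have "filterlim S (at 0) sequentially"
      using S by (simp add: filterlim_at)
    ultimately have "(\<lambda>n. (exp ((1 + S n) * g x) - exp (g x)) / S n) \<longlonglongrightarrow> g x * exp (g x)"
      by (rule filterlim_compose)
    then show ?thesis by (intro tendsto_mult tendsto_const)
  qed
  have dom: "norm (?q s x) \<le> ?B x" if "s \<noteq> 0" "\<bar>s\<bar> \<le> 1/4" for s x
  proof -
    have "norm (?q s x) = w x * \<bar>(exp ((1 + s) * g x) - exp (g x)) / s\<bar>"
      using w[of x] by (simp add: abs_mult)
    also have "\<dots> \<le> w x * (4 * (exp (3/2 * g x) + exp (1/2 * g x)))"
      using exp_difference_quotient_bound[OF that] w[of x] by (intro mult_left_mono)
    finally show ?thesis by (simp add: algebra_simps)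
  qed
  have conv: "integrable M ?L \<and> (\<lambda>n. \<integral>x. ?q (S n) x \<partial>M) \<longlonglongrightarrow> (\<integral>x. ?L x \<partial>M)"
    if S: "\<And>n. S n \<noteq> 0" "\<And>n. \<bar>S n\<bar> \<le> 1/4" "S \<longlonglongrightarrow> 0" for S
  proof -
    note * = B AE_I2[OF lim[OF S(1,3)]] AE_I2[OF dom[OF S(1,2)]]
    show ?thesis
      using integrable_dominated_convergence[OF _ _ *] integral_dominated_convergence[OF _ _ *] by simp
  qed
  \<comment> \<open>One admissible sequence is enough for the integrability of the limit; this one
    starts at 1/4, the largest step that the domination allows.\<close>
  have "(\<lambda>n. 1 / (4 * real (Suc n))) \<longlonglongrightarrow> 0"
    by real_asymp
  with conv[of "\<lambda>n. 1 / (4 * real (Suc n))"]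
  show "integrable M ?L" by (auto simp: field_simps)
  \<comment> \<open>Restricting to this interval makes every term of a test sequence dominated, not
    just the tail. As 0 is an interior point, the restriction does not change the limit.\<close>
  have "((\<lambda>s. \<integral>x. ?q s x \<partial>M) \<longlongrightarrow> (\<integral>x. ?L x \<partial>M)) (at 0 within {-1/4..1/4})"
    unfolding tendsto_at_iff_sequentially comp_def
  proof (intro allI impI)
    fix S :: "nat \<Rightarrow> real"
    assume S: "\<forall>n. S n \<in> {-1/4..1/4} - {0}" "S \<longlonglongrightarrow> 0"
    have "S n \<noteq> 0 \<and> \<bar>S n\<bar> \<le> 1/4" for n
      using spec[OF S(1), of n] unfolding abs_le_iff by auto
    with conv[of S] S(2) show "(\<lambda>n. \<integral>x. ?q (S n) x \<partial>M) \<longlonglongrightarrow> (\<integral>x. ?L x \<partial>M)"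
      by blast
  qed
  moreover have "at 0 within {-1/4..1/4} = at (0::real)"
    by (intro at_within_interior) simp
  ultimately have "((\<lambda>s. \<integral>x. ?q s x \<partial>M) \<longlongrightarrow> (\<integral>x. ?L x \<partial>M)) (at 0)"
    by simp
  moreover have "eventually (\<lambda>s. (\<integral>x. ?q s x \<partial>M) =
      ((\<integral>x. w x * exp ((1 + s) * g x) \<partial>M) - (\<integral>x. w x * exp (1 * g x) \<partial>M)) / s) (at 0)"
  proof -
    \<comment> \<open>Here 1 + s > 0, so both exponentials are integrable and the integral of the
      difference splits.\<close>
    have "eventually (\<lambda>s::real. s \<in> {-1<..<1}) (at 0)"
      by (intro eventually_at_in_open') auto
    then show ?thesis
    proof eventually_elim
      case (elim s)
      have "(\<integral>x. ?q s x \<partial>M) = (\<integral>x. (w x * exp ((1 + s) * g x) - w x * exp (1 * g x)) / s \<partial>M)"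
        by (simp add: right_diff_distrib)
      also have "\<dots> = (\<integral>x. w x * exp ((1 + s) * g x) - w x * exp (1 * g x) \<partial>M) / s"
        by (rule integral_divide_zero)
      also have "\<dots> = ((\<integral>x. w x * exp ((1 + s) * g x) \<partial>M) - (\<integral>x. w x * exp (1 * g x) \<partial>M)) / s"
        using elim int[of 1] by (subst Bochner_Integration.integral_diff) (auto intro!: int)
      finally show ?case .
    qed
  qed
  ultimately show "((\<lambda>t. \<integral>x. w x * exp (t * g x) \<partial>M) has_real_derivative (\<integral>x. ?L x \<partial>M)) (at 1)"
    unfolding DERIV_def by (rule Lim_transform_eventually)
qed

section \<open>Duality of \<open>h_entropy\<close> with \<open>exp\<close>, and convexity\<close>

lemma h_entropy_exp: "h_entropy (exp s) = s * exp s - exp s"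
  by (simp add: h_entropy_def mult.commute)

text \<open>For x > 0 this is 1 + u \<le> exp u at u = s - ln x, multiplied by x.\<close>

lemma h_entropy_young:
  assumes "x \<ge> 0"
  shows "s * x - exp s \<le> h_entropy x"
proof (cases "x = 0")
  case False
  with assms have x: "x > 0" by simp
  have "x * (1 + (s - ln x)) \<le> x * exp (s - ln x)"
    using x exp_ge_add_one_self by (intro mult_left_mono) auto
  then show ?thesis using x by (simp add: h_entropy_def exp_diff algebra_simps)
qed (simp add: h_entropy_def)

text \<open>Young's inequality with s = ln m is the tangent line to \<open>h_entropy\<close> at the
  mean m. Averaging the tangent bound over the three points cancels the linear term.\<close>

lemma h_entropy_convex3:
  assumes "0 < a" "0 \<le> b" "0 \<le> c" "a + b + c = 1" "0 \<le> x" "0 < y" "0 < z"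
  shows "h_entropy (a * x + b * y + c * z) \<le> a * h_entropy x + b * h_entropy y + c * h_entropy z"
proof (cases "a * x + b * y + c * z = 0")
  \<comment> \<open>At mean 0 there is no tangent line. Positivity of \<open>a\<close>,
    \<open>y\<close> and \<open>z\<close> then forces \<open>x\<close>, \<open>b\<close> and
    \<open>c\<close> to vanish.\<close>
  case True
  have "a * x \<ge> 0" "b * y \<ge> 0" "c * z \<ge> 0" using assms by auto
  with True have "a * x = 0" "b * y = 0" "c * z = 0" by linarith+
  then have "x = 0" "b = 0" "c = 0" using assms by auto
  then show ?thesis by (simp add: h_entropy_def)
next
  case False
  define m where "m = a * x + b * y + c * z"
  have "m \<ge> 0" unfolding m_def using assms by (intro add_nonneg_nonneg mult_nonneg_nonneg) auto
  with False have m: "m > 0" by (simp add: m_def)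
  have *: "h_entropy m + ln m * (u - m) \<le> h_entropy u" if "u \<ge> 0" for u
    using h_entropy_young[OF that, of "ln m"] m by (simp add: h_entropy_def algebra_simps)
  have "h_entropy m = (a + b + c) * h_entropy m + ln m * (m - (a + b + c) * m)"
    using assms by simp
  also have "\<dots> = a * (h_entropy m + ln m * (x - m)) + b * (h_entropy m + ln m * (y - m))
      + c * (h_entropy m + ln m * (z - m))"
    by (simp add: m_def algebra_simps)
  also have "\<dots> \<le> a * h_entropy x + b * h_entropy y + c * h_entropy z"
    using assms by (intro add_mono mult_left_mono *) auto
  finally show ?thesis by (simp add: m_def)
qed


section \<open>Weighted integrability, and the entropy of an exponential target\<close>

lemma integrable_bounded_scaleR:
  fixes F :: "'a \<Rightarrow> 'b::{banach, second_countable_topology}"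
  assumes "u \<in> borel_measurable M" "\<And>x. \<bar>u x\<bar> \<le> B" "integrable M F"
  shows "integrable M (\<lambda>x. u x *\<^sub>R F x)"
proof (rule Bochner_Integration.integrable_bound)
  show "integrable M (\<lambda>x. B *\<^sub>R F x)" using assms(3) by simp
  show "(\<lambda>x. u x *\<^sub>R F x) \<in> borel_measurable M" using assms by simp
  show "AE x in M. norm (u x *\<^sub>R F x) \<le> norm (B *\<^sub>R F x)"
    using order_trans[OF assms(2) abs_ge_self] by (auto intro!: mult_right_mono)
qed

lemma integrable_bounded_mult:
  fixes F :: "'a \<Rightarrow> real"
  assumes "u \<in> borel_measurable M" "\<And>x. \<bar>u x\<bar> \<le> B" "integrable M F"
  shows "integrable M (\<lambda>x. u x * F x)"
  using integrable_bounded_scaleR[OF assms] by simp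

text \<open>Since s |v|^2 \<le> exp(s |v|^2), the factor |v|^2 is paid for by the slack s in the
  exponent.\<close>

lemma integrable_exp_norm_sq:
  fixes w g :: "'a::euclidean_space \<Rightarrow> real"
  assumes [measurable]: "w \<in> borel_measurable lebesgue" "g \<in> borel_measurable lebesgue"
    and "\<And>v. w v \<ge> 0" "s > 0"
    and int: "integrable lebesgue (\<lambda>v. w v * exp (g v + s * (norm v)\<^sup>2))"
  shows "integrable lebesgue (\<lambda>v. w v * exp (g v) * (norm v)\<^sup>2)"
proof (rule Bochner_Integration.integrable_bound)
  show "integrable lebesgue (\<lambda>v. w v * exp (g v + s * (norm v)\<^sup>2) / s)"
    using int by simp
  have [measurable]: "(\<lambda>v::'a. v) \<in> borel_measurable lebesgue"
    by (rule measurable_completion) simp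
  show "(\<lambda>v. w v * exp (g v) * (norm v)\<^sup>2) \<in> borel_measurable lebesgue"
    by measurable
  have "w v * exp (g v) * (norm v)\<^sup>2 \<le> w v * exp (g v) * (exp (s * (norm v)\<^sup>2) / s)" for v
  proof (intro mult_left_mono)
    have "s * (norm v)\<^sup>2 \<le> exp (s * (norm v)\<^sup>2)"
      using exp_ge_add_one_self[of "s * (norm v)\<^sup>2"] by linarith
    then show "(norm v)\<^sup>2 \<le> exp (s * (norm v)\<^sup>2) / s"
      using \<open>s > 0\<close> by (simp add: field_simps)
  qed (use assms in auto)
  then show "AE v in lebesgue. norm (w v * exp (g v) * (norm v)\<^sup>2)
      \<le> norm (w v * exp (g v + s * (norm v)\<^sup>2) / s)"
    using assms by (auto simp: exp_add mult.assoc)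
qed

text \<open>The derivative \<open>D\<close> of the potential along the ray stays in the bound
  instead of being set to zero, because for a cross-species target it need not vanish on its
  own.\<close>

lemma exponential_projection_entropy:
  fixes a :: "'a \<Rightarrow> 'e::euclidean_space" and w f :: "'a \<Rightarrow> real"
  assumes [measurable]: "w \<in> borel_measurable M" "a \<in> borel_measurable M"
    and w: "\<And>x. w x \<ge> 0" and f: "\<And>x. f x \<ge> 0"
    and int: "\<And>t. 0 < t \<Longrightarrow> integrable M (\<lambda>x. w x * exp ((t *\<^sub>R l) \<bullet> a x))"
    and mom: "integrable M (\<lambda>x. (w x * f x) *\<^sub>R a x)"
    and ent: "integrable M (\<lambda>x. w x * h_entropy (f x))"
  shows "integrable M (\<lambda>x. w x * h_entropy (exp (l \<bullet> a x)))"
    and "\<exists>D. ((\<lambda>t. (\<integral>x. w x * exp ((t *\<^sub>R l) \<bullet> a x) \<partial>M)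
              - (t *\<^sub>R l) \<bullet> (\<integral>x. (w x * f x) *\<^sub>R a x \<partial>M)) has_real_derivative D) (at 1) \<and>
          (\<integral>x. w x * h_entropy (exp (l \<bullet> a x)) \<partial>M) \<le> (\<integral>x. w x * h_entropy (f x) \<partial>M) + D"
proof -
  let ?g = "\<lambda>x. l \<bullet> a x"
  have int': "integrable M (\<lambda>x. w x * exp (t * ?g x))" if "0 < t" for t
    using int[OF that] by simp
  note D = exp_integral_DERIV[of w M ?g, OF _ _ w int', simplified]
  have wg: "integrable M (\<lambda>x. w x * (?g x * exp (?g x)))"
    and we: "integrable M (\<lambda>x. w x * exp (?g x))"
    using D(1) int'[of 1] by auto
  have h_eq: "w x * h_entropy (exp (?g x)) = w x * (?g x * exp (?g x)) - w x * exp (?g x)" for x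
    by (simp add: h_entropy_exp algebra_simps)
  show "integrable M (\<lambda>x. w x * h_entropy (exp (?g x)))"
    unfolding h_eq by (intro Bochner_Integration.integrable_diff wg we)
  have wf: "integrable M (\<lambda>x. l \<bullet> ((w x * f x) *\<^sub>R a x))"
    using mom by (intro integrable_inner_right) auto
  have wf_eq: "(\<integral>x. l \<bullet> ((w x * f x) *\<^sub>R a x) \<partial>M) = l \<bullet> (\<integral>x. (w x * f x) *\<^sub>R a x \<partial>M)"
    using mom by (intro integral_inner_right)
  \<comment> \<open>With A = exp g this is the integral of w (A - f) log A.\<close>
  let ?D = "(\<integral>x. w x * (?g x * exp (?g x)) \<partial>M) - l \<bullet> (\<integral>x. (w x * f x) *\<^sub>R a x \<partial>M)"
  have "((\<lambda>t. (\<integral>x. w x * exp ((t *\<^sub>R l) \<bullet> a x) \<partial>M)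
          - (t *\<^sub>R l) \<bullet> (\<integral>x. (w x * f x) *\<^sub>R a x \<partial>M)) has_real_derivative ?D) (at 1)"
    using D(2) by (auto intro!: derivative_eq_intros)
  moreover have "(\<integral>x. w x * h_entropy (exp (?g x)) \<partial>M) \<le> (\<integral>x. w x * h_entropy (f x) \<partial>M) + ?D"
  proof -
    \<comment> \<open>Integrated Young inequality; adding \<open>?D\<close> to both sides turns the
      left one into the weighted entropy of the target.\<close>
    have "(\<integral>x. l \<bullet> ((w x * f x) *\<^sub>R a x) - w x * exp (?g x) \<partial>M) \<le> (\<integral>x. w x * h_entropy (f x) \<partial>M)"
    proof (intro integral_mono Bochner_Integration.integrable_diff wf we ent)
      fix x
      have "w x * (?g x * f x - exp (?g x)) \<le> w x * h_entropy (f x)"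
        by (intro mult_left_mono h_entropy_young w f)
      then show "l \<bullet> ((w x * f x) *\<^sub>R a x) - w x * exp (?g x) \<le> w x * h_entropy (f x)"
        by (simp add: algebra_simps)
    qed
    then show ?thesis
      unfolding h_eq using wf wg we by (simp add: wf_eq[simplified])
  qed
  ultimately show "\<exists>D. ((\<lambda>t. (\<integral>x. w x * exp ((t *\<^sub>R l) \<bullet> a x) \<partial>M)
              - (t *\<^sub>R l) \<bullet> (\<integral>x. (w x * f x) *\<^sub>R a x \<partial>M)) has_real_derivative D) (at 1) \<and>
          (\<integral>x. w x * h_entropy (exp (l \<bullet> a x)) \<partial>M) \<le> (\<integral>x. w x * h_entropy (f x) \<partial>M) + D"
    by blast
qed

text \<open>Fermat's rule at an interior point of the ray. \<open>Q\<close> has to agree with the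
  potential only for t > 0, which admits forms of it that rest on integrability inside the
  cone.\<close>

lemma minimizer_on_ray_stationary:
  fixes P :: "'a::real_vector \<Rightarrow> real"
  assumes min: "is_arg_min P (\<lambda>\<alpha>. \<alpha> \<in> S) l"
    and cone: "\<And>t. 0 < t \<Longrightarrow> t *\<^sub>R l \<in> S"
    and deriv: "(Q has_real_derivative D) (at 1)"
    and Q: "\<And>t. 0 < t \<Longrightarrow> Q t = P (t *\<^sub>R l)"
  shows "D = 0"
proof (rule DERIV_local_min[OF deriv zero_less_one], intro allI impI)
  \<comment> \<open>Radius 1 about t = 1 is what keeps t positive.\<close>
  fix t :: real assume "\<bar>1 - t\<bar> < 1"
  then have "0 < t" by simp
  then show "Q 1 \<le> Q t"
    using min cone[of t] Q[of 1] Q[of t] by (auto simp: is_arg_min_linorder)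
qed

section \<open>Entropy balance for the relaxation of one species\<close>

lemma relax_weights:
  assumes "dt > 0" "\<And>v. \<nu>s v \<ge> 0" "\<And>v. \<nu>x v \<ge> 0"
  defines "c \<equiv> relax_coeff dt \<nu>s \<nu>x"
  shows "0 < c v" "c v \<le> 1"
    and "0 \<le> c v * \<nu>s v" "c v * \<nu>s v \<le> 1 / dt"
    and "0 \<le> c v * \<nu>x v" "c v * \<nu>x v \<le> 1 / dt"
    and "c v + dt * (c v * \<nu>s v) + dt * (c v * \<nu>x v) = 1"
proof -
  have pos: "1 + dt * (\<nu>s v + \<nu>x v) > 0"
    using assms by (intro add_pos_nonneg mult_nonneg_nonneg) auto
  then show c: "0 < c v"
    by (simp add: c_def relax_coeff_def)
  show w: "0 \<le> c v * \<nu>s v" "0 \<le> c v * \<nu>x v"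
    using c assms(2,3)[of v] by simp_all
  \<comment> \<open>The upper bounds hold for unbounded frequencies too: three nonnegative terms
    with sum 1 are each at most 1.\<close>
  have "c v + dt * (c v * \<nu>s v) + dt * (c v * \<nu>x v) = c v * (1 + dt * (\<nu>s v + \<nu>x v))"
    by (simp add: algebra_simps)
  then show sum1: "c v + dt * (c v * \<nu>s v) + dt * (c v * \<nu>x v) = 1"
    using pos by (simp add: c_def relax_coeff_def)
  have "dt * (c v * \<nu>s v) \<ge> 0" "dt * (c v * \<nu>x v) \<ge> 0"
    using w \<open>dt > 0\<close> by auto
  with sum1 c have "c v \<le> 1" "dt * (c v * \<nu>s v) \<le> 1" "dt * (c v * \<nu>x v) \<le> 1"
    by linarith+
  then show "c v \<le> 1" "c v * \<nu>s v \<le> 1 / dt" "c v * \<nu>x v \<le> 1 / dt"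
    using \<open>dt > 0\<close> by (simp_all add: pos_le_divide_eq mult.commute)
qed

text \<open>\<open>Ds\<close> and \<open>Dx\<close> remain in the conclusion because the cross terms
  cancel only when both species are added. Integrability is part of the claim: the Bochner integral
  of a non-integrable function is 0 by convention.\<close>

lemma relax_entropy:
  fixes dt :: real and \<nu>s \<nu>x f gs gx :: "velocity \<Rightarrow> real"
  defines "ws \<equiv> \<lambda>v. relax_coeff dt \<nu>s \<nu>x v * \<nu>s v"
    and "wx \<equiv> \<lambda>v. relax_coeff dt \<nu>s \<nu>x v * \<nu>x v"
  assumes dt: "dt > 0"
    and [measurable]: "\<nu>s \<in> borel_measurable lebesgue" "\<nu>x \<in> borel_measurable lebesgue"
      "gs \<in> borel_measurable lebesgue" "gx \<in> borel_measurable lebesgue"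
    and nu: "\<And>v. \<nu>s v \<ge> 0" "\<And>v. \<nu>x v \<ge> 0" and f: "\<And>v. f v \<ge> 0"
    and f_int: "integrable lebesgue f" "integrable lebesgue (\<lambda>v. f v * (norm v)\<^sup>2)"
      "integrable lebesgue (\<lambda>v. h_entropy (f v))"
    and energy: "integrable lebesgue (\<lambda>v. ws v * exp (gs v) * (norm v)\<^sup>2)"
      "integrable lebesgue (\<lambda>v. wx v * exp (gx v) * (norm v)\<^sup>2)"
    and ent: "integrable lebesgue (\<lambda>v. ws v * h_entropy (exp (gs v)))"
      "integrable lebesgue (\<lambda>v. wx v * h_entropy (exp (gx v)))"
    and ent_le: "(\<integral>v. ws v * h_entropy (exp (gs v)) \<partial>lebesgue) \<le> (\<integral>v. ws v * h_entropy (f v) \<partial>lebesgue) + Ds"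
      "(\<integral>v. wx v * h_entropy (exp (gx v)) \<partial>lebesgue) \<le> (\<integral>v. wx v * h_entropy (f v) \<partial>lebesgue) + Dx"
  defines "f' \<equiv> relax dt \<nu>s \<nu>x (\<lambda>v. exp (gs v)) (\<lambda>v. exp (gx v)) f"
  shows "integrable lebesgue (\<lambda>v. h_entropy (f' v))"
    and "(\<integral>v. h_entropy (f' v) \<partial>lebesgue) \<le> (\<integral>v. h_entropy (f v) \<partial>lebesgue) + dt * (Ds + Dx)"
proof -
  let ?c = "relax_coeff dt \<nu>s \<nu>x"
  have [measurable]: "?c \<in> borel_measurable lebesgue"
    unfolding relax_coeff_def by measurable
  have [measurable]: "f \<in> borel_measurable lebesgue" using f_int(1) by simp
  have [measurable]: "ws \<in> borel_measurable lebesgue" "wx \<in> borel_measurable lebesgue"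
    unfolding ws_def wx_def by measurable
  have [measurable]: "f' \<in> borel_measurable lebesgue"
    unfolding f'_def relax_def by measurable
  note weights = relax_weights[where \<nu>s = \<nu>s and \<nu>x = \<nu>x, OF dt nu, folded ws_def wx_def]
  have c: "?c v > 0" and c1: "\<bar>?c v\<bar> \<le> 1"
    and w: "ws v \<ge> 0" "wx v \<ge> 0" and w1: "\<bar>ws v\<bar> \<le> 1 / dt" "\<bar>wx v\<bar> \<le> 1 / dt"
    and sum1: "?c v + dt * ws v + dt * wx v = 1" for v
    using weights[of v] by (simp_all add: ws_def wx_def)
  have f'_eq: "f' v = ?c v * f v + (dt * ws v) * exp (gs v) + (dt * wx v) * exp (gx v)" for v
    by (simp add: f'_def relax_def ws_def wx_def algebra_simps)
  have f'_nonneg: "f' v \<ge> 0" for v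
    unfolding f'_eq using c[of v] w[of v] f[of v] dt
    by (intro add_nonneg_nonneg mult_nonneg_nonneg) auto
  \<comment> \<open>Young's inequality at \<open>- |v|\<^sup>2 / 2\<close> makes the negative part of the entropy integrable: the constant
    lower bound \<open>-1\<close> of \<open>h\<close> would not.\<close>
  let ?up = "\<lambda>v. ?c v * h_entropy (f v) + dt * (ws v * h_entropy (exp (gs v))) + dt * (wx v * h_entropy (exp (gx v)))"
  let ?lo = "\<lambda>v. - ((norm v)\<^sup>2 / 2 * f' v) - exp (- (norm v)\<^sup>2 / 2)"
  have up: "h_entropy (f' v) \<le> ?up v" for v
  proof -
    have "h_entropy (f' v) \<le> ?c v * h_entropy (f v) + dt * ws v * h_entropy (exp (gs v)) + dt * wx v * h_entropy (exp (gx v))"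
      unfolding f'_eq using c w dt sum1 f by (intro h_entropy_convex3) auto
    then show ?thesis by (simp add: mult.assoc)
  qed
  have lo: "?lo v \<le> h_entropy (f' v)" for v
    using h_entropy_young[OF f'_nonneg, of "- (norm v)\<^sup>2 / 2" v] by simp
  have ch: "integrable lebesgue (\<lambda>v. ?c v * h_entropy (f v))"
    by (rule integrable_bounded_mult[OF _ c1 f_int(3)]) simp
  have wh: "integrable lebesgue (\<lambda>v. ws v * h_entropy (f v))" "integrable lebesgue (\<lambda>v. wx v * h_entropy (f v))"
    by (rule integrable_bounded_mult[OF _ w1(1) f_int(3)] integrable_bounded_mult[OF _ w1(2) f_int(3)]; simp)+
  have up_int: "integrable lebesgue ?up"
    using ch ent by auto
  \<comment> \<open>The second moment of \<open>f'\<close> is finite since the weighted second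
    moments of \<open>f\<close> and of both targets are.\<close>
  have lo_int: "integrable lebesgue ?lo"
  proof -
    have "integrable lebesgue (\<lambda>v. ?c v * (f v * (norm v)\<^sup>2))"
      by (rule integrable_bounded_mult[OF _ c1 f_int(2)]) simp
    then have "integrable lebesgue (\<lambda>v. (?c v * (f v * (norm v)\<^sup>2) + dt * (ws v * exp (gs v) * (norm v)\<^sup>2)
        + dt * (wx v * exp (gx v) * (norm v)\<^sup>2)) / 2)"
      using energy by auto
    also have "(\<lambda>v. (?c v * (f v * (norm v)\<^sup>2) + dt * (ws v * exp (gs v) * (norm v)\<^sup>2)
        + dt * (wx v * exp (gx v) * (norm v)\<^sup>2)) / 2) = (\<lambda>v. (norm v)\<^sup>2 / 2 * f' v)"
      by (rule ext) (simp add: f'_eq algebra_simps add_divide_distrib)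
    finally show ?thesis
      using integrable_gaussian[where 'a = velocity]
      by (intro Bochner_Integration.integrable_diff integrable_minus) (auto simp: integrable_completion)
  qed
  show int: "integrable lebesgue (\<lambda>v. h_entropy (f' v))"
  proof (rule Bochner_Integration.integrable_bound)
    show "integrable lebesgue (\<lambda>v. \<bar>?up v\<bar> + \<bar>?lo v\<bar>)"
      by (rule Bochner_Integration.integrable_add[OF integrable_abs[OF up_int] integrable_abs[OF lo_int]])
    show "(\<lambda>v. h_entropy (f' v)) \<in> borel_measurable lebesgue"
      unfolding h_entropy_def by measurable
    have "\<bar>h_entropy (f' v)\<bar> \<le> \<bar>?up v\<bar> + \<bar>?lo v\<bar>" for v
      using up[of v] lo[of v] by linarith
    then show "AE v in lebesgue. norm (h_entropy (f' v)) \<le> norm (\<bar>?up v\<bar> + \<bar>?lo v\<bar>)"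
      unfolding real_norm_def by (intro AE_I2) (rule order_trans[OF _ abs_ge_self])
  qed
  have "(\<integral>v. h_entropy (f' v) \<partial>lebesgue) \<le> (\<integral>v. ?up v \<partial>lebesgue)"
    by (intro integral_mono int up_int up)
  also have "\<dots> = (\<integral>v. ?c v * h_entropy (f v) \<partial>lebesgue) + dt * (\<integral>v. ws v * h_entropy (exp (gs v)) \<partial>lebesgue)
      + dt * (\<integral>v. wx v * h_entropy (exp (gx v)) \<partial>lebesgue)"
    using ch ent by simp
  also have "\<dots> \<le> (\<integral>v. ?c v * h_entropy (f v) \<partial>lebesgue) + dt * ((\<integral>v. ws v * h_entropy (f v) \<partial>lebesgue) + Ds)
      + dt * ((\<integral>v. wx v * h_entropy (f v) \<partial>lebesgue) + Dx)"
    using dt ent_le by (intro add_mono mult_left_mono order_refl) auto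
  \<comment> \<open>With the targets replaced by \<open>f\<close>, all three terms carry the same
    entropy, and the weights sum to 1.\<close>
  also have "\<dots> = (\<integral>v. ?c v * h_entropy (f v) + dt * (ws v * h_entropy (f v)) + dt * (wx v * h_entropy (f v)) \<partial>lebesgue)
      + dt * (Ds + Dx)"
    using ch wh by (simp add: algebra_simps)
  also have "(\<lambda>v. ?c v * h_entropy (f v) + dt * (ws v * h_entropy (f v)) + dt * (wx v * h_entropy (f v))) =
      (\<lambda>v. (?c v + dt * ws v + dt * wx v) * h_entropy (f v))"
    by (simp add: algebra_simps)
  finally show "(\<integral>v. h_entropy (f' v) \<partial>lebesgue) \<le> (\<integral>v. h_entropy (f v) \<partial>lebesgue) + dt * (Ds + Dx)"
    by (simp add: sum1)
qed

section \<open>Moments, minimizers and a single collision type\<close>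

lemma integrable_summands_nonneg:
  fixes u v :: "'a \<Rightarrow> real"
  assumes "u \<in> borel_measurable M" "v \<in> borel_measurable M"
    and nonneg: "\<And>x. u x \<ge> 0" "\<And>x. v x \<ge> 0" and int: "integrable M (\<lambda>x. u x + v x)"
  shows "integrable M u" "integrable M v"
  using assms(1,2) nonneg by (auto intro!: Bochner_Integration.integrable_bound[OF int])

lemma is_arg_min_arg_min_on:
  assumes "\<exists>!x. is_arg_min f (\<lambda>x. x \<in> S) x"
  shows "is_arg_min f (\<lambda>x. x \<in> S) (arg_min_on f S)"
  unfolding arg_min_on_def arg_min_def using assms by (blast intro: someI)

lemma integrable_moments:
  fixes f :: "velocity \<Rightarrow> real"
  assumes "integrable lebesgue f" "integrable lebesgue (\<lambda>v. f v *\<^sub>R v)"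
    "integrable lebesgue (\<lambda>v. f v * (norm v)\<^sup>2)"
  shows "integrable lebesgue (\<lambda>v. f v *\<^sub>R avec m v)"
    and "integrable lebesgue (\<lambda>v. f v *\<^sub>R avec12 m v)"
    and "integrable lebesgue (\<lambda>v. f v *\<^sub>R avec21 m v)"
proof -
  have "integrable lebesgue (\<lambda>v. m *\<^sub>R (f v, f v *\<^sub>R v, f v * (norm v)\<^sup>2))"
    "integrable lebesgue (\<lambda>v. m *\<^sub>R (f v, 0 :: real, f v *\<^sub>R v, f v * (norm v)\<^sup>2))"
    "integrable lebesgue (\<lambda>v. m *\<^sub>R (0 :: real, f v, f v *\<^sub>R v, f v * (norm v)\<^sup>2))"
    using assms by (safe intro!: integrable_scaleR_right integrable_Pair integrable_zero)
  then show "integrable lebesgue (\<lambda>v. f v *\<^sub>R avec m v)"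
    and "integrable lebesgue (\<lambda>v. f v *\<^sub>R avec12 m v)"
    and "integrable lebesgue (\<lambda>v. f v *\<^sub>R avec21 m v)"
    by (simp_all add: avec_def avec12_def avec21_def scaleR_prod_def mult_ac scaleR_left_commute)
qed

lemma avec_measurable:
  "avec m \<in> borel_measurable lebesgue" "avec12 m \<in> borel_measurable lebesgue"
  "avec21 m \<in> borel_measurable lebesgue"
  unfolding avec_def avec12_def avec21_def
  by (auto intro!: measurable_completion borel_measurable_continuous_onI continuous_intros)

text \<open>Supplies what \<open>relax_entropy\<close> asks of one target. The second parameter
  \<open>l'\<close> gives a target with slower decay that is still integrable; the gap s |v|^2
  between the exponents yields the second moment of the target at \<open>l\<close>.\<close>

lemma collision_projection:
  fixes a :: "velocity \<Rightarrow> 'e::euclidean_space" and w f :: "velocity \<Rightarrow> real"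
  assumes w_meas [measurable]: "w \<in> borel_measurable lebesgue" and a_meas [measurable]: "a \<in> borel_measurable lebesgue"
    and w: "\<And>v. 0 \<le> w v" "\<And>v. w v \<le> B" and f: "\<And>v. f v \<ge> 0"
    and fa: "integrable lebesgue (\<lambda>v. f v *\<^sub>R a v)"
    and hf: "integrable lebesgue (\<lambda>v. h_entropy (f v))"
    and ray: "\<forall>t>0. t *\<^sub>R l \<in> S"
    and int: "\<forall>\<alpha>\<in>S. integrable lebesgue (\<lambda>v. w v * exp (\<alpha> \<bullet> a v))"
    and l': "l' \<in> S" "0 < s" "\<And>v. l' \<bullet> a v = l \<bullet> a v + s * (norm v)\<^sup>2"
  shows "integrable lebesgue (\<lambda>v. (w v * f v) *\<^sub>R a v)"
    and "integrable lebesgue (\<lambda>v. w v * h_entropy (exp (l \<bullet> a v)))"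
    and "integrable lebesgue (\<lambda>v. w v * exp (l \<bullet> a v) * (norm v)\<^sup>2)"
    and "\<exists>D. ((\<lambda>t. (\<integral>v. w v * exp ((t *\<^sub>R l) \<bullet> a v) \<partial>lebesgue)
              - (t *\<^sub>R l) \<bullet> (\<integral>v. (w v * f v) *\<^sub>R a v \<partial>lebesgue)) has_real_derivative D) (at 1) \<and>
          (\<integral>v. w v * h_entropy (exp (l \<bullet> a v)) \<partial>lebesgue) \<le> (\<integral>v. w v * h_entropy (f v) \<partial>lebesgue) + D"
proof -
  have wB: "\<bar>w v\<bar> \<le> B" for v using w[of v] by simp
  show wfa: "integrable lebesgue (\<lambda>v. (w v * f v) *\<^sub>R a v)"
    using integrable_bounded_scaleR[OF w_meas wB fa] by simp
  have wh: "integrable lebesgue (\<lambda>v. w v * h_entropy (f v))"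
    by (rule integrable_bounded_mult[OF w_meas wB hf])
  show "integrable lebesgue (\<lambda>v. w v * exp (l \<bullet> a v) * (norm v)\<^sup>2)"
    using bspec[OF int l'(1)] l'(2,3) w by (intro integrable_exp_norm_sq[where s = s]) auto
  have int_ray: "integrable lebesgue (\<lambda>v. w v * exp ((t *\<^sub>R l) \<bullet> a v))" if "0 < t" for t
    using ray int that by blast
  note E = exponential_projection_entropy[OF w_meas a_meas w(1) f int_ray wfa wh]
  from E(1) show "integrable lebesgue (\<lambda>v. w v * h_entropy (exp (l \<bullet> a v)))" .
  from E(2) show "\<exists>D. ((\<lambda>t. (\<integral>v. w v * exp ((t *\<^sub>R l) \<bullet> a v) \<partial>lebesgue)
              - (t *\<^sub>R l) \<bullet> (\<integral>v. (w v * f v) *\<^sub>R a v \<partial>lebesgue)) has_real_derivative D) (at 1) \<and>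
          (\<integral>v. w v * h_entropy (exp (l \<bullet> a v)) \<partial>lebesgue) \<le> (\<integral>v. w v * h_entropy (f v) \<partial>lebesgue) + D" .
qed

section \<open>The parameter domains: rays and room for slower decay\<close>

lemma cone_Lam: "\<alpha> \<in> Lam \<Longrightarrow> 0 < t \<Longrightarrow> t *\<^sub>R \<alpha> \<in> Lam"
  by (auto simp: Lam_def mult_pos_neg)

lemma cone_Lam12: "\<alpha> \<in> Lam12 \<Longrightarrow> 0 < t \<Longrightarrow> t *\<^sub>R \<alpha> \<in> Lam12"
  by (auto simp: Lam12_def mult_pos_neg)

text \<open>Halving the negative last coordinate r stays in the domain and raises the exponent by -m
  r |v|^2 / 2.\<close>

lemma Lam_slower_decay:
  assumes "l \<in> Lam" "m > 0"
  obtains l' s where "l' \<in> Lam" "0 < s" "\<And>v. l' \<bullet> avec m v = l \<bullet> avec m v + s * (norm v)\<^sup>2"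
proof -
  obtain p q r where l: "l = (p, q, r)" "r < 0"
    using assms by (auto simp: Lam_def)
  show ?thesis
    using l assms(2)
    by (intro that[of "(p, q, r / 2)" "- m * r / 2"])
       (auto simp: Lam_def avec_def mult_pos_neg field_simps)
qed

text \<open>The cross-species parameter is shared, so one \<open>l'\<close> has to work in both
  exponents; hence the mass stays outside \<open>s\<close>.\<close>

lemma Lam12_slower_decay:
  assumes "l \<in> Lam12"
  obtains l' s where "l' \<in> Lam12" "0 < s"
    "\<And>m v. l' \<bullet> avec12 m v = l \<bullet> avec12 m v + m * s * (norm v)\<^sup>2"
    "\<And>m v. l' \<bullet> avec21 m v = l \<bullet> avec21 m v + m * s * (norm v)\<^sup>2"
proof -
  obtain p p' q r where l: "l = (p, p', q, r)" "r < 0"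
    using assms by (auto simp: Lam12_def)
  show ?thesis
    using l
    by (intro that[of "(p, p', q, r / 2)" "- r / 2"])
       (auto simp: Lam12_def avec12_def avec21_def field_simps)
qed

section \<open>Both species together: the cross-species derivatives cancel\<close>

theorem proposition5p5:
  fixes m1 m2 dt :: real
    and \<nu>11 \<nu>12 \<nu>21 \<nu>22 f1 f2 f1' f2' :: "velocity \<Rightarrow> real"
  assumes "m1 > 0" "m2 > 0" "dt > 0"
    and nu_measurable:
      "\<nu>11 \<in> borel_measurable lebesgue" "\<nu>12 \<in> borel_measurable lebesgue"
      "\<nu>21 \<in> borel_measurable lebesgue" "\<nu>22 \<in> borel_measurable lebesgue"
    and nu_nonneg:
      "\<And>v. \<nu>11 v \<ge> 0" "\<And>v. \<nu>12 v \<ge> 0" "\<And>v. \<nu>21 v \<ge> 0" "\<And>v. \<nu>22 v \<ge> 0"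
    and f_nonneg: "\<And>v. f1 v \<ge> 0" "\<And>v. f2 v \<ge> 0"
    and f1_moments:
      "integrable lebesgue f1" "integrable lebesgue (\<lambda>v. f1 v *\<^sub>R v)"
      "integrable lebesgue (\<lambda>v. f1 v * (norm v)\<^sup>2)"
    and f2_moments:
      "integrable lebesgue f2" "integrable lebesgue (\<lambda>v. f2 v *\<^sub>R v)"
      "integrable lebesgue (\<lambda>v. f2 v * (norm v)\<^sup>2)"
    and entropy_integrable:
      "integrable lebesgue (\<lambda>v. h_entropy (f1 v))" "integrable lebesgue (\<lambda>v. h_entropy (f2 v))"
    and finite_integrals:
      "\<And>\<alpha>. \<alpha> \<in> Lam \<Longrightarrow>
        integrable lebesgue (\<lambda>v. relax_coeff dt \<nu>11 \<nu>12 v * \<nu>11 v * exp (\<alpha> \<bullet> avec m1 v))"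
      "\<And>\<alpha>. \<alpha> \<in> Lam \<Longrightarrow>
        integrable lebesgue (\<lambda>v. relax_coeff dt \<nu>22 \<nu>21 v * \<nu>22 v * exp (\<alpha> \<bullet> avec m2 v))"
      "\<And>\<alpha>. \<alpha> \<in> Lam12 \<Longrightarrow>
        integrable lebesgue (\<lambda>v. relax_coeff dt \<nu>11 \<nu>12 v * \<nu>12 v * exp (\<alpha> \<bullet> avec12 m1 v)
          + relax_coeff dt \<nu>22 \<nu>21 v * \<nu>21 v * exp (\<alpha> \<bullet> avec21 m2 v))"
    and unique_minimizers:
      "\<exists>!l. is_arg_min (potential m1 dt \<nu>11 \<nu>12 f1) (\<lambda>\<alpha>. \<alpha> \<in> Lam) l"
      "\<exists>!l. is_arg_min (potential m2 dt \<nu>22 \<nu>21 f2) (\<lambda>\<alpha>. \<alpha> \<in> Lam) l"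
      "\<exists>!l. is_arg_min (potential12 m1 m2 dt \<nu>11 \<nu>12 \<nu>21 \<nu>22 f1 f2) (\<lambda>\<alpha>. \<alpha> \<in> Lam12) l"
    and step: "(f1', f2') = relaxation_step m1 m2 dt \<nu>11 \<nu>12 \<nu>21 \<nu>22 (f1, f2)"
  shows "integrable lebesgue (\<lambda>v. h_entropy (f1' v)) \<and> integrable lebesgue (\<lambda>v. h_entropy (f2' v)) \<and>
    (\<integral>v. h_entropy (f1' v) + h_entropy (f2' v) \<partial>lebesgue) \<le> (\<integral>v. h_entropy (f1 v) + h_entropy (f2 v) \<partial>lebesgue)"
proof -
  define l1 where "l1 = arg_min_on (potential m1 dt \<nu>11 \<nu>12 f1) Lam"
  define l2 where "l2 = arg_min_on (potential m2 dt \<nu>22 \<nu>21 f2) Lam"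
  define l where "l = arg_min_on (potential12 m1 m2 dt \<nu>11 \<nu>12 \<nu>21 \<nu>22 f1 f2) Lam12"
  have min1: "is_arg_min (potential m1 dt \<nu>11 \<nu>12 f1) (\<lambda>\<alpha>. \<alpha> \<in> Lam) l1"
    and min2: "is_arg_min (potential m2 dt \<nu>22 \<nu>21 f2) (\<lambda>\<alpha>. \<alpha> \<in> Lam) l2"
    and min12: "is_arg_min (potential12 m1 m2 dt \<nu>11 \<nu>12 \<nu>21 \<nu>22 f1 f2) (\<lambda>\<alpha>. \<alpha> \<in> Lam12) l"
    unfolding l1_def l2_def l_def using unique_minimizers by (auto intro: is_arg_min_arg_min_on)
  then have l1: "l1 \<in> Lam" and l2: "l2 \<in> Lam" and l: "l \<in> Lam12"
    by (auto simp: is_arg_min_def)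
  have f1'_eq: "f1' = relax dt \<nu>11 \<nu>12 (\<lambda>v. exp (l1 \<bullet> avec m1 v)) (\<lambda>v. exp (l \<bullet> avec12 m1 v)) f1"
    and f2'_eq: "f2' = relax dt \<nu>22 \<nu>21 (\<lambda>v. exp (l2 \<bullet> avec m2 v)) (\<lambda>v. exp (l \<bullet> avec21 m2 v)) f2"
    using step by (simp_all add: relaxation_step_def Let_def l1_def l2_def l_def)
  note [measurable] = nu_measurable avec_measurable
  let ?c1 = "relax_coeff dt \<nu>11 \<nu>12" and ?c2 = "relax_coeff dt \<nu>22 \<nu>21"
  have [measurable]: "?c1 \<in> borel_measurable lebesgue" "?c2 \<in> borel_measurable lebesgue"
    unfolding relax_coeff_def by measurable
  note W1 = relax_weights[where \<nu>s = \<nu>11 and \<nu>x = \<nu>12, OF \<open>dt > 0\<close> nu_nonneg(1,2)]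
  note W2 = relax_weights[where \<nu>s = \<nu>22 and \<nu>x = \<nu>21, OF \<open>dt > 0\<close> nu_nonneg(4,3)]
  obtain k1 s1 where k1: "k1 \<in> Lam" "0 < s1" "\<And>v. k1 \<bullet> avec m1 v = l1 \<bullet> avec m1 v + s1 * (norm v)\<^sup>2"
    using Lam_slower_decay[OF l1 \<open>m1 > 0\<close>] by blast
  obtain k2 s2 where k2: "k2 \<in> Lam" "0 < s2" "\<And>v. k2 \<bullet> avec m2 v = l2 \<bullet> avec m2 v + s2 * (norm v)\<^sup>2"
    using Lam_slower_decay[OF l2 \<open>m2 > 0\<close>] by blast
  obtain k s where k: "k \<in> Lam12" "0 < s"
    "\<And>m v. k \<bullet> avec12 m v = l \<bullet> avec12 m v + m * s * (norm v)\<^sup>2"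
    "\<And>m v. k \<bullet> avec21 m v = l \<bullet> avec21 m v + m * s * (norm v)\<^sup>2"
    using Lam12_slower_decay[OF l] by blast
  have w_meas: "(\<lambda>v. ?c1 v * \<nu>11 v) \<in> borel_measurable lebesgue" "(\<lambda>v. ?c1 v * \<nu>12 v) \<in> borel_measurable lebesgue"
    "(\<lambda>v. ?c2 v * \<nu>22 v) \<in> borel_measurable lebesgue" "(\<lambda>v. ?c2 v * \<nu>21 v) \<in> borel_measurable lebesgue"
    by measurable
  have ms: "0 < m1 * s" "0 < m2 * s"
    using k(2) \<open>m1 > 0\<close> \<open>m2 > 0\<close> by simp_all
  \<comment> \<open>The assumption covers only the sum of the two integrands; nonnegativity
    separates them.\<close>
  have int12: "\<forall>\<alpha>\<in>Lam12. integrable lebesgue (\<lambda>v. ?c1 v * \<nu>12 v * exp (\<alpha> \<bullet> avec12 m1 v))"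
    and int21: "\<forall>\<alpha>\<in>Lam12. integrable lebesgue (\<lambda>v. ?c2 v * \<nu>21 v * exp (\<alpha> \<bullet> avec21 m2 v))"
    by (intro ballI; rule integrable_summands_nonneg[OF _ _ _ _ finite_integrals(3)];
        use W1(5) W2(5) in simp)+
  note mom1 = integrable_moments[OF f1_moments] and mom2 = integrable_moments[OF f2_moments]
  have int11: "\<forall>\<alpha>\<in>Lam. integrable lebesgue (\<lambda>v. ?c1 v * \<nu>11 v * exp (\<alpha> \<bullet> avec m1 v))"
    and int22: "\<forall>\<alpha>\<in>Lam. integrable lebesgue (\<lambda>v. ?c2 v * \<nu>22 v * exp (\<alpha> \<bullet> avec m2 v))"
    using finite_integrals(1,2) by blast+
  have ray1: "\<forall>t>0. t *\<^sub>R l1 \<in> Lam" and ray2: "\<forall>t>0. t *\<^sub>R l2 \<in> Lam" and ray: "\<forall>t>0. t *\<^sub>R l \<in> Lam12"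
    using cone_Lam[OF l1] cone_Lam[OF l2] cone_Lam12[OF l] by blast+
  note P11 = collision_projection[OF w_meas(1) avec_measurable(1) W1(3,4) f_nonneg(1) mom1(1) entropy_integrable(1)
      ray1 int11 k1]
  note P12 = collision_projection[OF w_meas(2) avec_measurable(2) W1(5,6) f_nonneg(1) mom1(2) entropy_integrable(1)
      ray int12 k(1) ms(1) k(3)]
  note P22 = collision_projection[OF w_meas(3) avec_measurable(1) W2(3,4) f_nonneg(2) mom2(1) entropy_integrable(2)
      ray2 int22 k2]
  note P21 = collision_projection[OF w_meas(4) avec_measurable(3) W2(5,6) f_nonneg(2) mom2(3) entropy_integrable(2)
      ray int21 k(1) ms(2) k(4)]
  obtain D11 where D11: "((\<lambda>t. potential m1 dt \<nu>11 \<nu>12 f1 (t *\<^sub>R l1)) has_real_derivative D11) (at 1)"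
    and le11: "(\<integral>v. ?c1 v * \<nu>11 v * h_entropy (exp (l1 \<bullet> avec m1 v)) \<partial>lebesgue)
      \<le> (\<integral>v. ?c1 v * \<nu>11 v * h_entropy (f1 v) \<partial>lebesgue) + D11"
    using P11(4)[folded potential_def] by (elim exE conjE) (rule that)
  obtain D22 where D22: "((\<lambda>t. potential m2 dt \<nu>22 \<nu>21 f2 (t *\<^sub>R l2)) has_real_derivative D22) (at 1)"
    and le22: "(\<integral>v. ?c2 v * \<nu>22 v * h_entropy (exp (l2 \<bullet> avec m2 v)) \<partial>lebesgue)
      \<le> (\<integral>v. ?c2 v * \<nu>22 v * h_entropy (f2 v) \<partial>lebesgue) + D22"
    using P22(4)[folded potential_def] by (elim exE conjE) (rule that)
  let ?G12 = "\<lambda>t. (\<integral>v. ?c1 v * \<nu>12 v * exp ((t *\<^sub>R l) \<bullet> avec12 m1 v) \<partial>lebesgue)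
    - (t *\<^sub>R l) \<bullet> (\<integral>v. (?c1 v * \<nu>12 v * f1 v) *\<^sub>R avec12 m1 v \<partial>lebesgue)"
  let ?G21 = "\<lambda>t. (\<integral>v. ?c2 v * \<nu>21 v * exp ((t *\<^sub>R l) \<bullet> avec21 m2 v) \<partial>lebesgue)
    - (t *\<^sub>R l) \<bullet> (\<integral>v. (?c2 v * \<nu>21 v * f2 v) *\<^sub>R avec21 m2 v \<partial>lebesgue)"
  obtain D12 where D12: "(?G12 has_real_derivative D12) (at 1)"
    and le12: "(\<integral>v. ?c1 v * \<nu>12 v * h_entropy (exp (l \<bullet> avec12 m1 v)) \<partial>lebesgue)
      \<le> (\<integral>v. ?c1 v * \<nu>12 v * h_entropy (f1 v) \<partial>lebesgue) + D12"
    using P12(4) by (elim exE conjE) (rule that)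
  obtain D21 where D21: "(?G21 has_real_derivative D21) (at 1)"
    and le21: "(\<integral>v. ?c2 v * \<nu>21 v * h_entropy (exp (l \<bullet> avec21 m2 v)) \<partial>lebesgue)
      \<le> (\<integral>v. ?c2 v * \<nu>21 v * h_entropy (f2 v) \<partial>lebesgue) + D21"
    using P21(4) by (elim exE conjE) (rule that)
  have "D11 = 0" "D22 = 0"
    by (rule minimizer_on_ray_stationary[OF min1 cone_Lam[OF l1] D11 refl]
        minimizer_on_ray_stationary[OF min2 cone_Lam[OF l2] D22 refl]; assumption)+
  \<comment> \<open>The shared \<open>l\<close> minimizes the joint potential, so stationarity
    concerns the sum only.\<close>
  moreover have "D12 + D21 = 0"
  proof (rule minimizer_on_ray_stationary[OF min12 cone_Lam12[OF l] DERIV_add[OF D12 D21]])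
    fix t :: real assume "0 < t"
    then have t: "t *\<^sub>R l \<in> Lam12" by (rule cone_Lam12[OF l])
    show "?G12 t + ?G21 t = potential12 m1 m2 dt \<nu>11 \<nu>12 \<nu>21 \<nu>22 f1 f2 (t *\<^sub>R l)"
      \<comment> \<open>Splitting the exponential integral requires both parts integrable at t l,
        hence t > 0.\<close>
      unfolding potential12_def Bochner_Integration.integral_add[OF bspec[OF int12 t] bspec[OF int21 t]]
        Bochner_Integration.integral_add[OF P12(1) P21(1)] inner_add_right by linarith
  qed
  \<comment> \<open>Grouped by species, to match the error terms of \<open>R1\<close> and
    \<open>R2\<close>.\<close>
  ultimately have D: "dt * (D11 + D12) + dt * (D22 + D21) = 0"
    by (simp flip: distrib_left)
  have exponent_meas: "(\<lambda>v. \<alpha> \<bullet> avec m v) \<in> borel_measurable lebesgue"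
    "(\<lambda>v. \<beta> \<bullet> avec12 m v) \<in> borel_measurable lebesgue"
    "(\<lambda>v. \<beta> \<bullet> avec21 m v) \<in> borel_measurable lebesgue" for \<alpha> \<beta> m
    by measurable
  note R1 = relax_entropy[OF \<open>dt > 0\<close> nu_measurable(1,2) exponent_meas(1,2) nu_nonneg(1,2) f_nonneg(1)
      f1_moments(1,3) entropy_integrable(1) P11(3) P12(3) P11(2) P12(2) le11 le12, folded f1'_eq]
  note R2 = relax_entropy[OF \<open>dt > 0\<close> nu_measurable(4,3) exponent_meas(1,3) nu_nonneg(4,3) f_nonneg(2)
      f2_moments(1,3) entropy_integrable(2) P22(3) P21(3) P22(2) P21(2) le22 le21, folded f2'_eq]
  have "(\<integral>v. h_entropy (f1' v) + h_entropy (f2' v) \<partial>lebesgue)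
      = (\<integral>v. h_entropy (f1' v) \<partial>lebesgue) + (\<integral>v. h_entropy (f2' v) \<partial>lebesgue)"
    by (rule Bochner_Integration.integral_add[OF R1(1) R2(1)])
  also have "\<dots> \<le> (\<integral>v. h_entropy (f1 v) \<partial>lebesgue) + (\<integral>v. h_entropy (f2 v) \<partial>lebesgue)"
    using R1(2) R2(2) D by linarith
  also have "\<dots> = (\<integral>v. h_entropy (f1 v) + h_entropy (f2 v) \<partial>lebesgue)"
    by (rule Bochner_Integration.integral_add[OF entropy_integrable, symmetric])
  finally show ?thesis
    using R1(1) R2(1) by blast
qed

end
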